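(* Let $X$ be a locally convex Hausdorff real topological vector space and let $(f_i)_{i\in I}$ be an infinite family of proper functions $f_i:X\to\mathbb R\cup\{+\infty\}$ with robust sum $f$. Assume that $$\inf(\mathrm{RP}_{x^*})=\max(\mathrm{RD}_{x^*})\quad\text{for all }x^*\in\bigcup_{x\in X}\partial f(x).$$ Then $$\partial f(x)=\bigcup_{J\in S_f(x)}\ \sum_{j\in J}\partial f_j(x),\quad\forall x\in X.$$
   Context: $X^*$ is the topological dual of $X$ and $\langle x^*,x\rangle$ the duality pairing. $\mathcal F(I)$ is the collection of all nonempty finite subsets of $I$. The robust sum is $f(x)=\sum_{i\in I}^R f_i(x):=\sup_{J\in\mathcal F(I)}\sum_{i\in J}f_i(x)$. For $h:X\to\overline{\mathbb R}$, $\operatorname{dom}h=\{x:h(x)<+\infty\}$, $h^*(x^* )=\sup_{x\in X}\{\langle x^*,x\rangle-h(x)\}$, and $\partial h(a)=\{x^*\in X^*: h(x)\ge h(a)+\langle x^*,x-a\rangle\ \forall x\in X\}$ if $h(a)\in\mathbb R$, $\partial h(a)=\emptyset$ otherwise. For $x^*\in X^*$: $(\mathrm{RP}_{x^*})$ is the problem $\inf\{f(x)-\langle x^*,x\rangle:x\in X\}$ and $(\mathrm{RD}_{x^*})$ is the problem $\sup\{-\sum_{j\in J}f_j^*(x_j^* ): J\in\mathcal F(I),\ (x_j^* )_{j\in J}\in(X^* )^J,\ \sum_{j\in J}x_j^*=x^*\}$. The equality $\inf(\mathrm{RP}_{x^*})=\max(\mathrm{RD}_{x^*})$ means that the two optimal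 values coincide and that the supremum in $(\mathrm{RD}_{x^*})$ is attained. For $x\in X$: $S_f(x)=\{J\in\mathcal F(I):\sum_{j\in J}f_j(x)=f(x)\}$ if $x\in\operatorname{dom}f$, and $S_f(x)=\emptyset$ otherwise. Sums of sets are Minkowski sums (a sum with an empty summand is empty). *)

theory Defs
  imports "HOL-Analysis.Analysis" "HOL-Library.Function_Algebras"
begin

text \<open>Hausdorff locally convex real topological vector spaces. Scalar multiplication is required to
  be jointly continuous, in the style of the library's topological algebra classes; local convexity
  says that the origin has a neighbourhood base of convex sets. The last line of the class is
  \<^const>\<open>convex\<close> written out, since that constant is not available inside a class specification.\<close>

class locally_convex_space = real_vector + topological_ab_group_add + t2_space +
  assumes tendsto_scaleR_Pair:
    "LIM p (nhds c \<times>\<^sub>F nhds a). fst p *\<^sub>R snd p :> nhds (c *\<^sub>R a)"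
  assumes convex_nhds_base:
    "open U \<Longrightarrow> 0 \<in> U \<Longrightarrow> \<exists>V C. open V \<and> 0 \<in> V \<and> V \<subseteq> C \<and> C \<subseteq> U \<and>
       (\<forall>x\<in>C. \<forall>y\<in>C. \<forall>u\<ge>0. \<forall>v\<ge>0. u + v = 1 \<longrightarrow> u *\<^sub>R x + v *\<^sub>R y \<in> C)"

instance real_normed_vector \<subseteq> locally_convex_space
proof
  fix c :: real and a :: 'a
  show "LIM p (nhds c \<times>\<^sub>F nhds a). fst p *\<^sub>R snd p :> nhds (c *\<^sub>R a)"
    by (intro tendsto_scaleR filterlim_fst filterlim_snd)
next
  fix U :: "'a set"
  assume "open U" "0 \<in> U"
  then obtain e where e: "e > 0" "ball 0 e \<subseteq> U"
    using openE by blast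
  then show "\<exists>V C. open V \<and> 0 \<in> V \<and> V \<subseteq> C \<and> C \<subseteq> U \<and>
      (\<forall>x\<in>C. \<forall>y\<in>C. \<forall>u\<ge>0. \<forall>v\<ge>0. u + v = 1 \<longrightarrow> u *\<^sub>R x + v *\<^sub>R y \<in> C)"
    using convex_ball[of "0::'a" e, unfolded convex_def]
    by (intro exI[of _ "ball 0 e"]) simp
qed

text \<open>The dual is a set of plain functions, so that the pairing is function application, sums of
  functionals are pointwise, and sums of sets of functionals are the Minkowski sums of
  \<^theory>\<open>HOL-Library.Set_Algebras\<close> over \<^theory>\<open>HOL-Library.Function_Algebras\<close>.\<close>

definition topological_dual :: "('a::{real_vector, topological_space} \<Rightarrow> real) set" where
  "topological_dual = {\<phi>. linear \<phi> \<and> continuous_on UNIV \<phi>}"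

definition dom :: "('a \<Rightarrow> ereal) \<Rightarrow> 'a set" where
  "dom h = {x. h x < \<infinity>}"

definition proper_fun :: "('a \<Rightarrow> ereal) \<Rightarrow> bool" where
  "proper_fun h \<longleftrightarrow> (\<forall>x. h x \<noteq> -\<infinity>) \<and> dom h \<noteq> {}"

definition conjugate :: "('a \<Rightarrow> ereal) \<Rightarrow> ('a \<Rightarrow> real) \<Rightarrow> ereal" where
  "conjugate h \<phi> = (SUP x. ereal (\<phi> x) - h x)"

definition subdifferential ::
    "('a::{real_vector, topological_space} \<Rightarrow> ereal) \<Rightarrow> 'a \<Rightarrow> ('a \<Rightarrow> real) set" where
  "subdifferential h a =
     (if \<bar>h a\<bar> \<noteq> \<infinity>
      then {\<phi> \<in> topological_dual. \<forall>x. h x \<ge> h a + ereal (\<phi> (x - a))}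
      else {})"

definition fin_subsets :: "'i set \<Rightarrow> 'i set set" where
  "fin_subsets I = {J. J \<subseteq> I \<and> finite J \<and> J \<noteq> {}}"

definition robust_sum :: "'i set \<Rightarrow> ('i \<Rightarrow> 'a \<Rightarrow> ereal) \<Rightarrow> 'a \<Rightarrow> ereal" where
  "robust_sum I f x = (SUP J\<in>fin_subsets I. \<Sum>i\<in>J. f i x)"

definition RP_inf :: "'i set \<Rightarrow> ('i \<Rightarrow> 'a \<Rightarrow> ereal) \<Rightarrow> ('a \<Rightarrow> real) \<Rightarrow> ereal" where
  "RP_inf I f \<phi> = (INF x. robust_sum I f x - ereal (\<phi> x))"

definition RD_feasible ::
    "'i set \<Rightarrow> ('a::{real_vector, topological_space} \<Rightarrow> real) \<Rightarrow> ('i set \<times> ('i \<Rightarrow> 'a \<Rightarrow> real)) set" where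
  "RD_feasible I \<phi> =
     {(J, \<psi>). J \<in> fin_subsets I \<and> \<psi> \<in> J \<rightarrow>\<^sub>E topological_dual \<and> (\<Sum>j\<in>J. \<psi> j) = \<phi>}"

definition RD_objective ::
    "('i \<Rightarrow> 'a \<Rightarrow> ereal) \<Rightarrow> 'i set \<times> ('i \<Rightarrow> 'a \<Rightarrow> real) \<Rightarrow> ereal" where
  "RD_objective f = (\<lambda>(J, \<psi>). - (\<Sum>j\<in>J. conjugate (f j) (\<psi> j)))"

definition RD_sup ::
    "'i set \<Rightarrow> ('i \<Rightarrow> 'a::{real_vector, topological_space} \<Rightarrow> ereal) \<Rightarrow> ('a \<Rightarrow> real) \<Rightarrow> ereal" where
  "RD_sup I f \<phi> = (SUP p\<in>RD_feasible I \<phi>. RD_objective f p)"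

definition exact_subsets :: "'i set \<Rightarrow> ('i \<Rightarrow> 'a \<Rightarrow> ereal) \<Rightarrow> 'a \<Rightarrow> 'i set set" where
  "exact_subsets I f x =
     (if x \<in> dom (robust_sum I f)
      then {J \<in> fin_subsets I. (\<Sum>j\<in>J. f j x) = robust_sum I f x}
      else {})"

end

theory Submission
  imports Defs
begin

text \<open>For \<open>\<phi> \<in> \<partial>f(x)\<close> the primal value is \<open>f(x) - \<phi>(x)\<close>. A dual optimal solution \<open>(J, \<psi>)\<close> therefore
  satisfies \<open>\<Sum>\<^sub>J (f\<^sub>j(x) + f\<^sub>j\<^sup>*(\<psi>\<^sub>j) - \<psi>\<^sub>j(x)) = \<Sum>\<^sub>J f\<^sub>j(x) - f(x) \<le> 0\<close>, whereas each summand is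
  nonnegative by the Fenchel-Young inequality. Hence all of them vanish, which says both that \<open>J\<close> is
  exact at \<open>x\<close> and that \<open>\<psi>\<^sub>j \<in> \<partial>f\<^sub>j(x)\<close>. The other inclusion needs no duality.\<close>

lemma sum_fun_apply: "(\<Sum>j\<in>J. \<psi> j) x = (\<Sum>j\<in>J. \<psi> j x)"
  by (induction J rule: infinite_finite_induct) auto

lemma sum_in_topological_dual:
  assumes "\<And>j. j \<in> J \<Longrightarrow> \<psi> j \<in> topological_dual"
  shows "(\<Sum>j\<in>J. \<psi> j) \<in> topological_dual"
proof -
  have "(\<Sum>j\<in>J. \<psi> j) = (\<lambda>x. \<Sum>j\<in>J. \<psi> j x)"
    by (simp add: fun_eq_iff sum_fun_apply)
  with assms show ?thesis
    unfolding topological_dual_def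
    by (auto intro!: linear_compose_sum continuous_on_sum)
qed

lemma sum_le_robust_sum: "J \<in> fin_subsets I \<Longrightarrow> (\<Sum>j\<in>J. f j x) \<le> robust_sum I f x"
  unfolding robust_sum_def by (rule SUP_upper)

lemma conjugate_ge: "ereal (\<phi> x) - h x \<le> conjugate h \<phi>"
  unfolding conjugate_def by (rule SUP_upper) simp

text \<open>Properness supplies a point where \<open>h\<close> is finite, and the term of the
  supremum at that point is a real lower bound. This is what makes the conjugates in a dual optimal
  solution real.\<close>

lemma conjugate_not_MInf:
  assumes "proper_fun h"
  shows "conjugate h \<phi> \<noteq> -\<infinity>"
proof -
  from assms obtain x where "h x \<noteq> -\<infinity>" "h x \<noteq> \<infinity>"
    by (auto simp: proper_fun_def dom_def)
  with conjugate_ge[of \<phi> x h] show ?thesis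
    by (cases "h x") auto
qed

text \<open>By linearity of \<open>\<phi>\<close>, the subgradient inequality at \<open>x\<close>
  says precisely that \<open>x\<close> minimises the primal objective.\<close>

lemma RP_inf_eq:
  assumes "\<phi> \<in> subdifferential (robust_sum I f) x"
  shows "RP_inf I f \<phi> = robust_sum I f x - ereal (\<phi> x)"
  unfolding RP_inf_def
proof (rule antisym[OF INF_lower INF_greatest])
  fix y
  from assms have "linear \<phi>" and fin: "\<bar>robust_sum I f x\<bar> \<noteq> \<infinity>"
    and le: "robust_sum I f x + ereal (\<phi> (y - x)) \<le> robust_sum I f y"
    by (auto simp: subdifferential_def topological_dual_def split: if_splits)
  then have "\<phi> (y - x) = \<phi> y - \<phi> x"
    by (simp add: linear_diff)
  with fin le show "robust_sum I f x - ereal (\<phi> x) \<le> robust_sum I f y - ereal (\<phi> y)"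
    by (cases "robust_sum I f x"; cases "robust_sum I f y") auto
qed simp

text \<open>The subgradient inequalities add up over \<open>J\<close>. Exactness is used only at
  \<open>x\<close>; at any other \<open>y\<close> the partial sum is merely a lower bound for the
  robust sum.\<close>

lemma sum_subdifferential_subset:
  assumes "J \<in> exact_subsets I f x"
    and "\<And>j. j \<in> J \<Longrightarrow> \<psi> j \<in> subdifferential (f j) x"
  shows "(\<Sum>j\<in>J. \<psi> j) \<in> subdifferential (robust_sum I f) x"
proof -
  from assms(1) have J: "J \<in> fin_subsets I" and exact: "(\<Sum>j\<in>J. f j x) = robust_sum I f x"
    by (auto simp: exact_subsets_def split: if_splits)
  have \<psi>: "\<psi> j \<in> topological_dual" "\<bar>f j x\<bar> \<noteq> \<infinity>" "f j x + ereal (\<psi> j (y - x)) \<le> f j y"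
    if "j \<in> J" for j y
    using assms(2)[OF that] by (auto simp: subdifferential_def split: if_splits)
  have "robust_sum I f x + ereal ((\<Sum>j\<in>J. \<psi> j) (y - x)) \<le> robust_sum I f y" for y
  proof -
    have "robust_sum I f x + ereal ((\<Sum>j\<in>J. \<psi> j) (y - x)) = (\<Sum>j\<in>J. f j x + ereal (\<psi> j (y - x)))"
      by (simp add: exact[symmetric] sum_fun_apply sum.distrib)
    also have "\<dots> \<le> (\<Sum>j\<in>J. f j y)"
      by (intro sum_mono \<psi>(3))
    also have "\<dots> \<le> robust_sum I f y"
      by (rule sum_le_robust_sum[OF J])
    finally show ?thesis .
  qed
  moreover have "\<bar>robust_sum I f x\<bar> \<noteq> \<infinity>"
    unfolding exact[symmetric] using \<psi>(2) by (simp add: sum_Inf)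
  moreover have "(\<Sum>j\<in>J. \<psi> j) \<in> topological_dual"
    by (rule sum_in_topological_dual) (rule \<psi>(1))
  ultimately show ?thesis
    by (simp add: subdifferential_def)
qed

text \<open>The hypothesis \<open>opt\<close> combines the absence of a duality gap with attainment
  at \<open>(J, \<psi>)\<close>.\<close>

lemma subdifferential_decomposition:
  assumes proper: "\<And>i. i \<in> I \<Longrightarrow> proper_fun (f i)"
    and \<phi>: "\<phi> \<in> subdifferential (robust_sum I f) x"
    and feasible: "(J, \<psi>) \<in> RD_feasible I \<phi>"
    and opt: "RD_objective f (J, \<psi>) = RP_inf I f \<phi>"
  shows "J \<in> exact_subsets I f x" and "\<And>j. j \<in> J \<Longrightarrow> \<psi> j \<in> subdifferential (f j) x"
proof -
  from feasible have J: "J \<in> fin_subsets I" "finite J" and J_I: "\<And>j. j \<in> J \<Longrightarrow> j \<in> I"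
    and dual: "\<And>j. j \<in> J \<Longrightarrow> \<psi> j \<in> topological_dual" and sum_\<psi>: "(\<Sum>j\<in>J. \<psi> j) = \<phi>"
    by (auto simp: RD_feasible_def fin_subsets_def)
  from \<phi> have "\<bar>robust_sum I f x\<bar> \<noteq> \<infinity>"
    by (auto simp: subdifferential_def split: if_splits)
  then obtain r where r: "robust_sum I f x = ereal r"
    by auto
  from opt have conj_sum: "(\<Sum>j\<in>J. conjugate (f j) (\<psi> j)) = ereal (\<phi> x - r)"
    unfolding RP_inf_eq[OF \<phi>] r RD_objective_def
    by (cases "\<Sum>j\<in>J. conjugate (f j) (\<psi> j)") auto
  \<comment> \<open>In \<open>ereal\<close> a single summand \<infinity> makes a finite sum
    \<infinity>, even next to -\<infinity>. A real value, or a real upper bound as in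
    \<open>le\<close> below, therefore excludes \<infinity> from every summand; properness excludes
    -\<infinity>. From there on the argument runs in the reals, where terms cancel.\<close>
  have "conjugate (f j) (\<psi> j) \<noteq> \<infinity>" if "j \<in> J" for j
    using conj_sum that J(2) by (metis PInfty_neq_ereal(1) sum_Pinfty)
  then have "\<forall>j\<in>J. \<exists>c. conjugate (f j) (\<psi> j) = ereal c"
    using conjugate_not_MInf proper J_I by (metis ereal_cases)
  then obtain c where c: "\<And>j. j \<in> J \<Longrightarrow> conjugate (f j) (\<psi> j) = ereal (c j)"
    by metis
  have le: "(\<Sum>j\<in>J. f j x) \<le> ereal r"
    using sum_le_robust_sum[OF J(1), of f x] r by simp
  then have "f j x \<noteq> \<infinity>" if "j \<in> J" for j
    using that J(2) by (metis PInfty_neq_ereal(1) ereal_infty_less_eq(1) sum_Pinfty)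
  moreover have "f j x \<noteq> -\<infinity>" if "j \<in> J" for j
    using proper[OF J_I[OF that]] by (simp add: proper_fun_def)
  ultimately have "\<forall>j\<in>J. \<exists>v. f j x = ereal v"
    by (metis ereal_cases)
  then obtain v where v: "\<And>j. j \<in> J \<Longrightarrow> f j x = ereal (v j)"
    by metis
  have sum_c: "(\<Sum>j\<in>J. c j) = \<phi> x - r"
    using conj_sum c by simp
  have sum_v: "(\<Sum>j\<in>J. f j x) = ereal (\<Sum>j\<in>J. v j)"
    using v by simp
  have young: "0 \<le> v j + c j - \<psi> j x" if "j \<in> J" for j
    using conjugate_ge[of "\<psi> j" x "f j"] c[OF that] v[OF that] by simp
  \<comment> \<open>Feasibility makes the values \<open>\<psi> j x\<close> sum to
    \<open>\<phi> x\<close>, which cancels against \<open>sum_c\<close>.\<close>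
  have total: "(\<Sum>j\<in>J. v j + c j - \<psi> j x) = (\<Sum>j\<in>J. v j) - r"
    using sum_c sum_\<psi> by (auto simp: sum.distrib sum_subtractf sum_fun_apply)
  have "0 \<le> (\<Sum>j\<in>J. v j + c j - \<psi> j x)"
    by (intro sum_nonneg young)
  then have total_0: "(\<Sum>j\<in>J. v j + c j - \<psi> j x) = 0"
    using le sum_v total by simp
  then show "J \<in> exact_subsets I f x"
    using J(1) sum_v r total by (simp add: exact_subsets_def dom_def)
  show "\<psi> j \<in> subdifferential (f j) x" if "j \<in> J" for j
  proof -
    have eq: "v j + c j - \<psi> j x = 0"
      using sum_nonneg_0[OF J(2) young total_0 that] by simp
    have "linear (\<psi> j)"
      using dual[OF that] by (simp add: topological_dual_def)
    \<comment> \<open>Equality in Fenchel-Young turns the bound of the conjugate by its term at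
      \<open>y\<close> into the subgradient inequality at \<open>x\<close>. A value -\<infinity> at
      \<open>y\<close> would make the conjugate \<infinity>, against \<open>c\<close>.\<close>
    then have "f j x + ereal (\<psi> j (y - x)) \<le> f j y" for y
      using conjugate_ge[of "\<psi> j" y "f j"] eq c[OF that] v[OF that]
      by (cases "f j y") (auto simp: linear_diff)
    then show ?thesis
      using dual[OF that] v[OF that] by (simp add: subdifferential_def)
  qed
qed

theorem corollary4p3:
  fixes I :: "'i set"
    and f :: "'i \<Rightarrow> 'a::locally_convex_space \<Rightarrow> ereal"
  assumes "infinite I"
    and "\<And>i. i \<in> I \<Longrightarrow> proper_fun (f i)"
    and "\<And>\<phi>. \<phi> \<in> (\<Union>x. subdifferential (robust_sum I f) x) \<Longrightarrow>
           RP_inf I f \<phi> = RD_sup I f \<phi> \<and>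
           (\<exists>p\<in>RD_feasible I \<phi>. RD_objective f p = RD_sup I f \<phi>)"
  shows "\<forall>x. subdifferential (robust_sum I f) x =
           (\<Union>J\<in>exact_subsets I f x. \<Sum>j\<in>J. subdifferential (f j) x)"
proof (intro allI set_eqI iffI)
  fix x \<phi>
  assume \<phi>: "\<phi> \<in> subdifferential (robust_sum I f) x"
  then have "\<phi> \<in> (\<Union>x. subdifferential (robust_sum I f) x)"
    by blast
  from assms(3)[OF this] obtain J \<psi> where p: "(J, \<psi>) \<in> RD_feasible I \<phi>"
    "RD_objective f (J, \<psi>) = RP_inf I f \<phi>"
    by (metis surj_pair)
  note decomp = subdifferential_decomposition[OF assms(2) \<phi> p]
  from p(1) have "finite J" "\<phi> = (\<Sum>j\<in>J. \<psi> j)"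
    by (auto simp: RD_feasible_def fin_subsets_def)
  \<comment> \<open>Over a finite index set, membership in a Minkowski sum amounts to a choice of
    one element from each summand; here the choice is \<open>\<psi>\<close>.\<close>
  then have "\<phi> \<in> (\<Sum>j\<in>J. subdifferential (f j) x)"
    using decomp(2) by (auto simp: set_sum_alt)
  with decomp(1) show "\<phi> \<in> (\<Union>J\<in>exact_subsets I f x. \<Sum>j\<in>J. subdifferential (f j) x)"
    by blast
next
  fix x \<phi>
  assume "\<phi> \<in> (\<Union>J\<in>exact_subsets I f x. \<Sum>j\<in>J. subdifferential (f j) x)"
  then obtain J where J: "J \<in> exact_subsets I f x"
    and \<phi>: "\<phi> \<in> (\<Sum>j\<in>J. subdifferential (f j) x)"
    by blast
  from J have "finite J"
    by (auto simp: exact_subsets_def fin_subsets_def split: if_splits)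
  with \<phi> obtain \<psi> where "\<phi> = (\<Sum>j\<in>J. \<psi> j)" "\<And>j. j \<in> J \<Longrightarrow> \<psi> j \<in> subdifferential (f j) x"
    by (auto simp: set_sum_alt)
  with sum_subdifferential_subset[OF J] show "\<phi> \<in> subdifferential (robust_sum I f) x"
    by blast
qed

end
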